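(* Let $m\ge 1$ and $N$ be integers with $2m\le N$, and let $k=m^2$. In the $N\times N$ torus with unit link capacities, let $S$ be an $m\times m$ square block of nodes and let $T$ be an adjacent $m\times m$ square block, namely $S=\{0,\dots,m-1\}\times\{0,\dots,m-1\}$ and $T=\{m,\dots,2m-1\}\times\{0,\dots,m-1\}$. Let $d$ be a traffic matrix in which each node of $S$ sends one unit of traffic to a node of $T$ according to some bijection $S\to T$, with no other traffic (so $d$ has exactly $k$ sources and $k$ sinks). Then under the Valiant Load-Balancing (VLB) scheme some link carries load at least $$\frac{2\sqrt{k}}{4}\left(1-\frac{k}{N^2}\right).$$
   Context: Torus. $V=\{0,\dots,N-1\}^2$, with addition coordinatewise modulo $N$; each node $i$ has directed links $(i,i+e)$ of capacity $1$ for $e\in\{(1,0),(0,1),(-1,0),(0,-1)\}$. An automorphism is a bijection $\phi:V\to V$ mapping directed links to directed links. VLB scheme. For each ordered pair of nodes $(u,v)$ fix a unit flow $p^{u,v}$ from $u$ to $v$ (with $p^{u,u}=0$) supported on shortest (minimum-hop) paths from $u$ to $v$, such that the family is invariant under all automorphisms $\phi$ of the torus: $p^{\phi(u),\phi(v)}_{\phi(i),\phi(j)}=p^{u,v}_{i,j}$ for every link $(i,j)$ (for instance, splitting equally over all shortest paths). VLB routes the traffic of each source $s$ with destination $s'$ in two phases: first it is distributed uniformly over all $N^2$ nodes $w\in V$ (a fraction $1/N^2$ to each $w$) using $p^{s,w}$; then each $w$ forwards its share to $s'$ using $p^{w,s'}$. Thus, per unit of traffic from $s$ to $s'$, the amount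 placed on link $(i,j)$ is $\frac{1}{N^2}\sum_{w\in V}\big(p^{s,w}_{i,j}+p^{w,s'}_{i,j}\big)$. The load of a link is the sum over all source-destination pairs of the demand times this amount. *)

theory Defs
  imports Complex_Main "Graph_Theory.Pair_Digraph"
begin

type_synonym node = "int \<times> int"
type_synonym link = "node \<times> node"

definition torus_nodes :: "int \<Rightarrow> node set" where
  "torus_nodes N = {0..<N} \<times> {0..<N}"

definition torus_add :: "int \<Rightarrow> node \<Rightarrow> node \<Rightarrow> node" where
  "torus_add N i e = ((fst i + fst e) mod N, (snd i + snd e) mod N)"

text \<open>Links are ordered pairs of nodes, so for \<open>N = 2\<close>, where \<open>i + (1,0) = i + (-1,0)\<close>,
  there are no parallel links.\<close>

definition torus :: "int \<Rightarrow> (node, link) pre_digraph" where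
  "torus N = with_proj \<lparr>
     pverts = torus_nodes N,
     parcs = {(i, torus_add N i e) | i e.
                i \<in> torus_nodes N \<and> e \<in> {(1,0), (0,1), (-1,0), (0,-1)}} \<rparr>"

definition torus_automorphism :: "int \<Rightarrow> (node \<Rightarrow> node) \<Rightarrow> bool" where
  "torus_automorphism N \<phi> \<longleftrightarrow>
     bij_betw \<phi> (verts (torus N)) (verts (torus N)) \<and>
     (\<forall>(i, j) \<in> arcs (torus N). (\<phi> i, \<phi> j) \<in> arcs (torus N))"

definition shortest_path :: "('a, 'b) pre_digraph \<Rightarrow> 'a \<Rightarrow> 'b list \<Rightarrow> 'a \<Rightarrow> bool" where
  "shortest_path G u q v \<longleftrightarrow> pre_digraph.apath G u q v \<and>
     (\<forall>q'. pre_digraph.apath G u q' v \<longrightarrow> length q \<le> length q')"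

definition unit_flow :: "('a, 'b) pre_digraph \<Rightarrow> 'a \<Rightarrow> 'a \<Rightarrow> ('b \<Rightarrow> real) \<Rightarrow> bool" where
  "unit_flow G u v f \<longleftrightarrow>
     (\<forall>l \<in> arcs G. 0 \<le> f l) \<and>
     (\<forall>i \<in> verts G. sum f (out_arcs G i) - sum f (in_arcs G i)
                      = (if i = u then 1 else if i = v then -1 else 0))"

definition supported_on_shortest_paths ::
    "('a, 'b) pre_digraph \<Rightarrow> 'a \<Rightarrow> 'a \<Rightarrow> ('b \<Rightarrow> real) \<Rightarrow> bool" where
  "supported_on_shortest_paths G u v f \<longleftrightarrow>
     (\<forall>l \<in> arcs G. f l \<noteq> 0 \<longrightarrow> (\<exists>q. shortest_path G u q v \<and> l \<in> set q))"

text \<open>A family \<open>p\<close> as used by VLB; \<open>p u v (i, j)\<close> is the flow $p^{u,v}_{i,j}$.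
  Values outside the nodes and links of the torus are unconstrained and never used.\<close>

definition vlb_flows :: "int \<Rightarrow> (node \<Rightarrow> node \<Rightarrow> link \<Rightarrow> real) \<Rightarrow> bool" where
  "vlb_flows N p \<longleftrightarrow>
     (\<forall>u \<in> verts (torus N). \<forall>v \<in> verts (torus N). u \<noteq> v \<longrightarrow>
        unit_flow (torus N) u v (p u v) \<and>
        supported_on_shortest_paths (torus N) u v (p u v)) \<and>
     (\<forall>u \<in> verts (torus N). \<forall>l \<in> arcs (torus N). p u u l = 0) \<and>
     (\<forall>\<phi>. torus_automorphism N \<phi> \<longrightarrow>
        (\<forall>u \<in> verts (torus N). \<forall>v \<in> verts (torus N). \<forall>(i, j) \<in> arcs (torus N).
           p (\<phi> u) (\<phi> v) (\<phi> i, \<phi> j) = p u v (i, j)))"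

definition vlb_amount ::
    "int \<Rightarrow> (node \<Rightarrow> node \<Rightarrow> link \<Rightarrow> real) \<Rightarrow> node \<Rightarrow> node \<Rightarrow> link \<Rightarrow> real" where
  "vlb_amount N p s s' l =
     1 / (of_int N)\<^sup>2 * (\<Sum>w \<in> verts (torus N). p s w l + p w s' l)"

definition vlb_load ::
    "int \<Rightarrow> (node \<Rightarrow> node \<Rightarrow> link \<Rightarrow> real) \<Rightarrow> (node \<Rightarrow> node \<Rightarrow> real) \<Rightarrow> link \<Rightarrow> real" where
  "vlb_load N p d l =
     (\<Sum>(s, s') \<in> verts (torus N) \<times> verts (torus N). d s s' * vlb_amount N p s s' l)"

end

(* Among the links, consider the m links leading straight from S into T.  The first-phase traffic
   is invariant under the symmetries of the square S, so these links, being one of the four sides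
   of S, carry at least a quarter of the k (1 - k/N^2) units that must leave S.  Likewise the
   second-phase traffic is invariant under the symmetries of T, and the same links form a side
   of T, so they carry at least a quarter of the k (1 - k/N^2) units that must enter T.
   One of the m = sqrt k links carries at least the average. *)
theory Submission
  imports Defs
begin

section \<open>Nodes and links of the torus\<close>

lemma verts_torus: "verts (torus N) = {0..<N} \<times> {0..<N}"
  by (simp add: torus_def torus_nodes_def with_proj_def)

lemma arcs_torus:
  "arcs (torus N) = {(i, torus_add N i e) | i e.
     i \<in> torus_nodes N \<and> e \<in> {(1,0), (0,1), (-1,0), (0,-1)}}"
  by (simp add: torus_def with_proj_def)

lemma tail_torus [simp]: "tail (torus N) = fst"
  and head_torus [simp]: "head (torus N) = snd"
  by (simp_all add: torus_def with_proj_def)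

lemma arcs_torus_subset: "arcs (torus N) \<subseteq> verts (torus N) \<times> verts (torus N)"
  by (auto simp: arcs_torus verts_torus torus_nodes_def torus_add_def)

lemma finite_verts_torus [simp]: "finite (verts (torus N))"
  by (simp add: verts_torus)

lemma finite_arcs_torus [simp]: "finite (arcs (torus N))"
  by (rule finite_subset[OF arcs_torus_subset]) simp

lemma arc_torusI:
  assumes "i \<in> verts (torus N)" "e \<in> {(1,0), (0,1), (-1,0), (0,-1)}" "j = torus_add N i e"
  shows "(i, j) \<in> arcs (torus N)"
  using assms unfolding arcs_torus verts_torus torus_nodes_def by blast

lemma arc_torusE:
  assumes "(i, j) \<in> arcs (torus N)"
  obtains e where "i \<in> verts (torus N)" "e \<in> {(1,0), (0,1), (-1,0), (0,-1)}"
    "j = torus_add N i e"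
  using assms unfolding arcs_torus verts_torus torus_nodes_def by blast

text \<open>The set of steps is closed under negation. This is what allows flows to be reversed
  later.\<close>

lemma arcs_torus_sym:
  assumes "(i, j) \<in> arcs (torus N)"
  shows "(j, i) \<in> arcs (torus N)"
proof -
  obtain e where e: "i \<in> verts (torus N)" "e \<in> {(1,0), (0,1), (-1,0), (0,-1)}"
    "j = torus_add N i e"
    using assms by (rule arc_torusE)
  show ?thesis
  proof (rule arc_torusI)
    show "j \<in> verts (torus N)" using assms arcs_torus_subset by blast
    show "(- fst e, - snd e) \<in> {(1,0), (0,1), (-1,0), (0,-1)}" using e(2) by auto
    show "i = torus_add N j (- fst e, - snd e)"
      using e(1) by (auto simp: e(3) torus_add_def verts_torus mod_simps)
  qed
qed

section \<open>Automorphisms: reflections and the exchange of coordinates\<close>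

text \<open>An involution is its own inverse, so bijectivity comes for free; only the effect on a
  single step remains to be checked.\<close>

lemma torus_automorphismI:
  assumes inv: "\<And>i. i \<in> verts (torus N) \<Longrightarrow> \<phi> i \<in> verts (torus N) \<and> \<phi> (\<phi> i) = i"
    and step: "\<And>i e. i \<in> verts (torus N) \<Longrightarrow> e \<in> {(1,0), (0,1), (-1,0), (0,-1)} \<Longrightarrow>
      \<exists>e' \<in> {(1,0), (0,1), (-1,0), (0,-1)}. \<phi> (torus_add N i e) = torus_add N (\<phi> i) e'"
  shows "torus_automorphism N \<phi>"
  unfolding torus_automorphism_def
proof (intro conjI)
  show "bij_betw \<phi> (verts (torus N)) (verts (torus N))"
    by (rule bij_betw_byWitness[where f' = \<phi>]) (use inv in auto)
  have "(\<phi> i, \<phi> j) \<in> arcs (torus N)" if "(i, j) \<in> arcs (torus N)" for i j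
    using that by (elim arc_torusE) (metis arc_torusI inv step)
  then show "\<forall>(i, j) \<in> arcs (torus N). (\<phi> i, \<phi> j) \<in> arcs (torus N)" by auto
qed

lemma torus_automorphism_arc:
  "\<lbrakk>torus_automorphism N \<phi>; l \<in> arcs (torus N)\<rbrakk> \<Longrightarrow> map_prod \<phi> \<phi> l \<in> arcs (torus N)"
  by (cases l) (auto simp: torus_automorphism_def)

text \<open>Parametrised by the sum \<open>c\<close> of a column and its mirror image, so that axes
  between two columns are covered too. With \<open>c = m - 1\<close> the block \<open>S\<close> is
  mapped to itself; with \<open>c = 2 * m - 1\<close> the blocks \<open>S\<close> and
  \<open>T\<close> are exchanged.\<close>

definition reflect :: "int \<Rightarrow> int \<Rightarrow> node \<Rightarrow> node" where
  "reflect N c i = ((c - fst i) mod N, snd i)"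

lemma torus_automorphism_reflect: "torus_automorphism N (reflect N c)"
proof (rule torus_automorphismI)
  fix i assume i: "i \<in> verts (torus N)"
  then show "reflect N c i \<in> verts (torus N) \<and> reflect N c (reflect N c i) = i"
    by (auto simp: verts_torus reflect_def mod_simps)
  fix e :: node assume "e \<in> {(1,0), (0,1), (-1,0), (0,-1)}"
  then show "\<exists>e' \<in> {(1,0), (0,1), (-1,0), (0,-1)}.
      reflect N c (torus_add N i e) = torus_add N (reflect N c i) e'"
    by (intro bexI[of _ "(- fst e, snd e)"])
      (auto simp: reflect_def torus_add_def mod_simps algebra_simps)
qed

lemma torus_automorphism_swap: "torus_automorphism N prod.swap"
proof (rule torus_automorphismI)
  fix i assume "i \<in> verts (torus N)"
  then show "prod.swap i \<in> verts (torus N) \<and> prod.swap (prod.swap i) = i"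
    by (auto simp: verts_torus)
  fix e :: node assume "e \<in> {(1,0), (0,1), (-1,0), (0,-1)}"
  then show "\<exists>e' \<in> {(1,0), (0,1), (-1,0), (0,-1)}.
      prod.swap (torus_add N i e) = torus_add N (prod.swap i) e'"
    by (intro bexI[of _ "prod.swap e"]) (auto simp: torus_add_def)
qed

section \<open>Square blocks and their symmetries\<close>

definition square :: "int \<Rightarrow> int \<Rightarrow> node set" where
  "square a m = {a..a+m-1} \<times> {0..m-1}"

lemma card_square: "m \<ge> 0 \<Longrightarrow> real (card (square a m)) = (of_int m)\<^sup>2"
  by (simp add: square_def card_cartesian_product power2_eq_square)

lemma finite_square [simp]: "finite (square a m)"
  by (simp add: square_def)

text \<open>This \<open>c\<close> sends the first column \<open>a\<close> of one block to the last
  column \<open>b + m - 1\<close> of the other. Both blocks lie within \<open>0..N-1\<close>, so the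
  reduction modulo \<open>N\<close> has no effect on them.\<close>

lemma bij_betw_reflect_square:
  assumes "0 \<le> a" "a + m \<le> N" "0 \<le> b" "b + m \<le> N" "c = a + b + m - 1"
  shows "bij_betw (reflect N c) (square a m) (square b m)"
  by (rule bij_betw_byWitness[where f' = "reflect N c"])
    (use assms in \<open>auto simp: square_def reflect_def\<close>)

lemma bij_betw_swap_square: "bij_betw prod.swap (square 0 m) (square 0 m)"
  by (rule bij_betw_byWitness[where f' = prod.swap]) (auto simp: square_def)

section \<open>Invariant flow families and the traffic across a cut\<close>

text \<open>A locale, so that its results can be instantiated a second time with all flows
  reversed.\<close>

locale flow_family =
  fixes N :: int and p :: "node \<Rightarrow> node \<Rightarrow> link \<Rightarrow> real"
  assumes unit_flow:
      "\<lbrakk>u \<in> verts (torus N); v \<in> verts (torus N); u \<noteq> v\<rbrakk> \<Longrightarrow> unit_flow (torus N) u v (p u v)"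
    and zero_flow: "\<lbrakk>u \<in> verts (torus N); l \<in> arcs (torus N)\<rbrakk> \<Longrightarrow> p u u l = 0"
    and invariant: "\<lbrakk>torus_automorphism N \<phi>; u \<in> verts (torus N); v \<in> verts (torus N);
        (i, j) \<in> arcs (torus N)\<rbrakk> \<Longrightarrow> p (\<phi> u) (\<phi> v) (\<phi> i, \<phi> j) = p u v (i, j)"
begin

lemma nonneg:
  assumes "u \<in> verts (torus N)" "v \<in> verts (torus N)" "l \<in> arcs (torus N)"
  shows "0 \<le> p u v l"
  using assms unit_flow[of u v] zero_flow[of u l] by (cases "u = v") (auto simp: unit_flow_def)

text \<open>This is \<open>N\<close>-squared times the first-phase load when each node of
  \<open>S\<close> sends one unit. For the reversed family it describes the second-phase traffic
  towards \<open>S\<close>, read on the opposite link.\<close>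

definition spread :: "node set \<Rightarrow> link \<Rightarrow> real" where
  "spread S l = (\<Sum>s\<in>S. \<Sum>w\<in>verts (torus N). p s w l)"

lemma spread_nonneg:
  assumes "S \<subseteq> verts (torus N)" "l \<in> arcs (torus N)"
  shows "0 \<le> spread S l"
  unfolding spread_def using assms by (intro sum_nonneg nonneg) auto

text \<open>The intermediate node ranges over all nodes, which \<phi> permutes, so both sums can be
  reindexed along \<phi>.\<close>

lemma spread_invariant:
  assumes \<phi>: "torus_automorphism N \<phi>" and S: "S \<subseteq> verts (torus N)"
    and bij: "bij_betw \<phi> S S'" and l: "(i, j) \<in> arcs (torus N)"
  shows "spread S' (\<phi> i, \<phi> j) = spread S (i, j)"
proof -
  have V: "bij_betw \<phi> (verts (torus N)) (verts (torus N))"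
    using \<phi> by (simp add: torus_automorphism_def)
  have "spread S' (\<phi> i, \<phi> j) =
      (\<Sum>s\<in>S. \<Sum>w\<in>verts (torus N). p (\<phi> s) (\<phi> w) (\<phi> i, \<phi> j))"
    unfolding spread_def sum.reindex_bij_betw[OF bij, symmetric]
    by (rule sum.cong[OF refl], rule sum.reindex_bij_betw[OF V, symmetric])
  also have "\<dots> = spread S (i, j)"
    unfolding spread_def using S l by (intro sum.cong refl invariant[OF \<phi>]) auto
  finally show ?thesis .
qed

text \<open>Summing the node balances over \<open>S\<close> leaves the source term 1, cancelled by
  the sink term exactly when \<open>w\<close> lies in \<open>S\<close>.\<close>

lemma net_outflow:
  assumes S: "S \<subseteq> verts (torus N)" "finite S" and s: "s \<in> S" and w: "w \<in> verts (torus N)"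
  shows "(\<Sum>i\<in>S. sum (p s w) (out_arcs (torus N) i) - sum (p s w) (in_arcs (torus N) i))
    = (if w \<in> S then 0 else 1)"
proof (cases "s = w")
  case True
  have "sum (p w w) (out_arcs (torus N) i) = 0" "sum (p w w) (in_arcs (torus N) i) = 0" for i
    using zero_flow[OF w] by (auto intro!: sum.neutral)
  then show ?thesis using True s by simp
next
  case False
  have "(\<Sum>i\<in>S. sum (p s w) (out_arcs (torus N) i) - sum (p s w) (in_arcs (torus N) i))
    = (\<Sum>i\<in>S. (if i = s then 1 else 0) - (if i = w then 1 else 0))"
    using unit_flow[of s w] False S s w by (intro sum.cong refl) (fastforce simp: unit_flow_def)
  also have "\<dots> = (if w \<in> S then 0 else 1)"
    using S s by (simp add: sum_subtractf)
  finally show ?thesis .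
qed

text \<open>Each source in \<open>S\<close> sends one unit to every node outside \<open>S\<close>.
  The net outflow counts all of these units, and the gross outflow is at least as large.\<close>

lemma cut_bound:
  assumes S: "S \<subseteq> verts (torus N)"
  shows "real (card S) * (real (card (verts (torus N))) - real (card S))
    \<le> sum (spread S) {l \<in> arcs (torus N). fst l \<in> S \<and> snd l \<notin> S}"
proof -
  let ?V = "verts (torus N)" and ?A = "arcs (torus N)"
  have fin: "finite S" by (rule finite_subset[OF S]) simp
  have "real (card S) * (real (card ?V) - real (card S)) = (\<Sum>s\<in>S. real (card (?V - S)))"
    using S fin by (simp add: card_Diff_subset card_mono of_nat_diff)
  also have "\<dots> = (\<Sum>s\<in>S. \<Sum>w\<in>?V. if w \<in> S then 0 else 1)"
    by (simp add: sum.If_cases Diff_eq)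
  also have "\<dots> = (\<Sum>s\<in>S. \<Sum>w\<in>?V. \<Sum>i\<in>S.
      sum (p s w) (out_arcs (torus N) i) - sum (p s w) (in_arcs (torus N) i))"
    using net_outflow[OF S fin] by simp
  also have "\<dots> = (\<Sum>s\<in>S. \<Sum>w\<in>?V.
      sum (p s w) {l \<in> ?A. fst l \<in> S} - sum (p s w) {l \<in> ?A. snd l \<in> S})"
  proof (intro sum.cong refl)
    fix s w
    \<comment> \<open>The links are grouped by their tail here, and by their head in the next
      claim.\<close>
    have "(\<Sum>i\<in>S. sum (p s w) (out_arcs (torus N) i)) = sum (p s w) {l \<in> ?A. fst l \<in> S}"
    proof -
      have "(\<Sum>i\<in>S. sum (p s w) (out_arcs (torus N) i)) =
          (\<Sum>i\<in>S. sum (p s w) {l \<in> {l \<in> ?A. fst l \<in> S}. fst l = i})"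
        by (rule sum.cong[OF refl], rule sum.cong) auto
      also have "\<dots> = sum (p s w) {l \<in> ?A. fst l \<in> S}"
        using fin by (intro sum.group) auto
      finally show ?thesis .
    qed
    moreover have "(\<Sum>i\<in>S. sum (p s w) (in_arcs (torus N) i)) = sum (p s w) {l \<in> ?A. snd l \<in> S}"
    proof -
      have "(\<Sum>i\<in>S. sum (p s w) (in_arcs (torus N) i)) =
          (\<Sum>i\<in>S. sum (p s w) {l \<in> {l \<in> ?A. snd l \<in> S}. snd l = i})"
        by (rule sum.cong[OF refl], rule sum.cong) auto
      also have "\<dots> = sum (p s w) {l \<in> ?A. snd l \<in> S}"
        using fin by (intro sum.group) auto
      finally show ?thesis .
    qed
    ultimately show "(\<Sum>i\<in>S.
        sum (p s w) (out_arcs (torus N) i) - sum (p s w) (in_arcs (torus N) i)) =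
        sum (p s w) {l \<in> ?A. fst l \<in> S} - sum (p s w) {l \<in> ?A. snd l \<in> S}"
      by (simp add: sum_subtractf)
  qed
  also have "\<dots> = sum (spread S) {l \<in> ?A. fst l \<in> S} - sum (spread S) {l \<in> ?A. snd l \<in> S}"
  proof -
    have "(\<Sum>s\<in>S. \<Sum>w\<in>?V. sum (p s w) L) = sum (spread S) L" for L
      unfolding spread_def by (subst sum.swap[of _ L], subst sum.swap[of _ L]) simp
    then show ?thesis by (simp add: sum_subtractf)
  qed
  \<comment> \<open>Links inside \<open>S\<close> occur in both sums and cancel. Links entering
    \<open>S\<close> only lower the left side, as \<open>spread\<close> is nonnegative.\<close>
  also have "\<dots> \<le> sum (spread S) {l \<in> ?A. fst l \<in> S \<and> snd l \<notin> S}"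
  proof -
    have "sum (spread S) {l \<in> ?A. fst l \<in> S} \<le>
        sum (spread S) ({l \<in> ?A. fst l \<in> S \<and> snd l \<notin> S} \<union> {l \<in> ?A. snd l \<in> S})"
      using spread_nonneg[OF S] by (intro sum_mono2) auto
    also have "\<dots> = sum (spread S) {l \<in> ?A. fst l \<in> S \<and> snd l \<notin> S}
        + sum (spread S) {l \<in> ?A. snd l \<in> S}"
      by (intro sum.union_disjoint) auto
    finally show ?thesis by simp
  qed
  finally show ?thesis .
qed

section \<open>One side of the block carries a quarter of the outgoing traffic\<close>

text \<open>The links leaving the block are covered by four symmetric copies of its right side, so
  \<open>cut_bound\<close> is shared equally among them.\<close>

lemma side_bound:
  assumes m: "1 \<le> m" "2 * m \<le> N"
  shows "(of_int m)\<^sup>2 * ((of_int N)\<^sup>2 - (of_int m)\<^sup>2)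
    \<le> 4 * (\<Sum>y=0..m-1. spread (square 0 m) ((m-1, y), (m, y)))"
proof -
  let ?S = "square 0 m" and ?A = "arcs (torus N)" and ?r = "reflect N (m - 1)"
  let ?R = "(\<lambda>y. ((m-1, y), (m, y))) ` {0..m-1}"
  define g where "g = spread ?S"
  define C where "C = {l \<in> ?A. fst l \<in> ?S \<and> snd l \<notin> ?S}"
  have S: "?S \<subseteq> verts (torus N)" using m by (auto simp: square_def verts_torus)
  have RA: "?R \<subseteq> ?A"
    using m by (auto intro!: arc_torusI[where e = "(1,0)"] simp: verts_torus torus_add_def)
  have inv_r: "g (map_prod ?r ?r l) = g l" if "l \<in> ?A" for l
    using that spread_invariant[OF torus_automorphism_reflect S bij_betw_reflect_square[of 0 m N 0]] m
    unfolding g_def by (cases l) auto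
  have inv_s: "g (map_prod prod.swap prod.swap l) = g l" if "l \<in> ?A" for l
    using that spread_invariant[OF torus_automorphism_swap S bij_betw_swap_square]
    unfolding g_def by (cases l) auto
  have map_r: "map_prod ?r ?r l \<in> ?A" if "l \<in> ?A" for l
    by (intro torus_automorphism_arc torus_automorphism_reflect that)
  have map_s: "map_prod prod.swap prod.swap l \<in> ?A" if "l \<in> ?A" for l
    by (intro torus_automorphism_arc torus_automorphism_swap that)
  \<comment> \<open>\<open>?R\<close> is the right side and \<open>R'\<close> the left one;
    exchanging coordinates turns these into the top and bottom sides, which make up
    \<open>D\<close>.\<close>
  define R' where "R' = map_prod ?r ?r ` ?R"
  define D where "D = map_prod prod.swap prod.swap ` (?R \<union> R')"
  have RA': "R' \<subseteq> ?A" unfolding R'_def using RA by (intro image_subsetI map_r) (rule subsetD)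
  have DA: "D \<subseteq> ?A" unfolding D_def using RA RA' by (intro image_subsetI map_s) blast
  have fin: "finite R'" "finite D" by (simp_all add: R'_def D_def)
  have g0: "0 \<le> g l" if "l \<in> ?A" for l using spread_nonneg[OF S that] by (simp add: g_def)
  have Csub: "C \<subseteq> (?R \<union> R') \<union> D"
  proof
    fix l assume "l \<in> C"
    then obtain x y j where l: "l = ((x, y), j)" "((x, y), j) \<in> ?A"
      "0 \<le> x" "x \<le> m - 1" "0 \<le> y" "y \<le> m - 1" "j \<notin> ?S"
      unfolding C_def by (cases l) (auto simp: square_def)
    from l(2) obtain e where e: "e \<in> {(1,0), (0,1), (-1,0), (0,-1)}" "j = torus_add N (x, y) e"
      by (rule arc_torusE)
    \<comment> \<open>Column \<open>m\<close> is mirrored to -1, which wraps around to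
      \<open>N - 1\<close>.\<close>
    have r: "map_prod ?r ?r ((m-1, z), (m, z)) = ((0, z), (- 1 mod N, z))" for z
      by (simp add: reflect_def)
    have r_in: "map_prod ?r ?r ((m-1, z), (m, z)) \<in> R'" if "0 \<le> z" "z \<le> m - 1" for z
      unfolding R'_def using that by (intro imageI) auto
    from e(1) consider "e = (1,0)" | "e = (0,1)" | "e = (-1,0)" | "e = (0,-1)" by auto
    then show "l \<in> (?R \<union> R') \<union> D"
    proof cases
      case 1
      \<comment> \<open>There is no wrap-around, because \<open>x + 1 \<le> m < N\<close>.\<close>
      then have "j = (x + 1, y)" using e l m by (simp add: torus_add_def)
      with l have "l \<in> ?R" by (auto simp: square_def)
      then show ?thesis by simp
    next
      case 2
      then have "j = (x, y + 1)" using e l m by (simp add: torus_add_def)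
      with l have "l = map_prod prod.swap prod.swap ((m-1, x), (m, x))" by (auto simp: square_def)
      with l have "l \<in> D" unfolding D_def by fastforce
      then show ?thesis by simp
    next
      case 3
      then have j: "j = ((x - 1) mod N, y)" using e l m by (simp add: torus_add_def)
      \<comment> \<open>From any later column, a step to the left stays inside the block.\<close>
      have "x = 0"
      proof (rule ccontr)
        assume "x \<noteq> 0"
        then have "j = (x - 1, y)" using j l m by simp
        then show False using l \<open>x \<noteq> 0\<close> by (auto simp: square_def)
      qed
      then have "l = map_prod ?r ?r ((m-1, y), (m, y))" using l j r by simp
      then show ?thesis using r_in[of y] l by blast
    next
      case 4
      then have j: "j = (x, (y - 1) mod N)" using e l m by (simp add: torus_add_def)
      have "y = 0"
      proof (rule ccontr)
        assume "y \<noteq> 0"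
        then have "j = (x, y - 1)" using j l m by simp
        then show False using l \<open>y \<noteq> 0\<close> by (auto simp: square_def)
      qed
      then have "l = map_prod prod.swap prod.swap (map_prod ?r ?r ((m-1, x), (m, x)))"
        using l j r by simp
      moreover have "map_prod ?r ?r ((m-1, x), (m, x)) \<in> R'" using l by (intro r_in)
      ultimately have "l \<in> D" unfolding D_def by blast
      then show ?thesis by simp
    qed
  qed
  \<comment> \<open>Subadditivity is used because sides may coincide: for \<open>m = 1\<close> and
    \<open>N = 2\<close> the right and left sides are the same link.\<close>
  have sum_Un: "sum g (X \<union> Y) \<le> sum g X + sum g Y"
    if "finite X" "finite Y" "X \<subseteq> ?A" "Y \<subseteq> ?A" for X Y
    using that g0 sum.union_inter[of X Y g] sum_nonneg[of "X \<inter> Y" g] by force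
  have sum_img: "sum g (h ` X) \<le> sum g X"
    if "finite X" "X \<subseteq> ?A" "\<And>l. l \<in> ?A \<Longrightarrow> g (h l) = g l" for h X
  proof -
    have "sum g (h ` X) \<le> sum (g \<circ> h) X"
      by (rule sum_image_le) (use that g0 in auto)
    also have "\<dots> = sum g X" using that by (intro sum.cong) auto
    finally show ?thesis .
  qed
  have "(of_int m)\<^sup>2 * ((of_int N)\<^sup>2 - (of_int m)\<^sup>2) \<le> sum g C"
    using cut_bound[OF S] card_square[of m 0] m
    by (simp add: g_def C_def verts_torus card_cartesian_product power2_eq_square)
  also have "\<dots> \<le> sum g ((?R \<union> R') \<union> D)"
    using Csub RA RA' DA g0 fin by (intro sum_mono2) auto
  also have "\<dots> \<le> sum g (?R \<union> R') + sum g D"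
    using RA RA' DA fin by (intro sum_Un) auto
  \<comment> \<open>The factor 4 arises from two doublings: first by the exchange of coordinates,
    then by the reflection.\<close>
  also have "\<dots> \<le> 2 * sum g (?R \<union> R')"
    using sum_img[of "?R \<union> R'", OF _ _ inv_s] RA RA' fin unfolding D_def by simp
  also have "\<dots> \<le> 2 * (sum g ?R + sum g R')"
    using sum_Un[of ?R R'] RA RA' fin by simp
  also have "\<dots> \<le> 4 * sum g ?R"
    using sum_img[of ?R, OF _ _ inv_r] RA unfolding R'_def by simp
  also have "sum g ?R = (\<Sum>y=0..m-1. spread ?S ((m-1, y), (m, y)))"
    by (subst sum.reindex) (auto simp: inj_on_def g_def)
  finally show ?thesis by simp
qed

section \<open>The second phase by reversal of flows\<close>

text \<open>Turning every link around exchanges ingoing with outgoing links and source with sink, so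
  the balance equations persist.\<close>

lemma reversed: "flow_family N (\<lambda>u v (i, j). p v u (j, i))"
proof
  fix u v assume uv: "u \<in> verts (torus N)" "v \<in> verts (torus N)" "u \<noteq> v"
  have swap: "bij_betw prod.swap (out_arcs (torus N) i) (in_arcs (torus N) i)"
    "bij_betw prod.swap (in_arcs (torus N) i) (out_arcs (torus N) i)" for i
    by (rule bij_betw_byWitness[where f' = prod.swap]; auto intro: arcs_torus_sym)+
  have q: "(\<lambda>(i, j). p v u (j, i)) = (\<lambda>l. p v u (prod.swap l))"
    by auto
  show "unit_flow (torus N) u v (\<lambda>(i, j). p v u (j, i))"
    using unit_flow[OF uv(2,1)] uv(3)
    unfolding unit_flow_def q sum.reindex_bij_betw[OF swap(1)] sum.reindex_bij_betw[OF swap(2)]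
    by (fastforce intro: arcs_torus_sym)
next
  fix u l assume "u \<in> verts (torus N)" "l \<in> arcs (torus N)"
  then show "(case l of (i, j) \<Rightarrow> p u u (j, i)) = 0"
    by (cases l) (simp add: zero_flow arcs_torus_sym)
next
  fix \<phi> u v i j
  assume "torus_automorphism N \<phi>" "u \<in> verts (torus N)" "v \<in> verts (torus N)"
    "(i, j) \<in> arcs (torus N)"
  then show "(case (\<phi> i, \<phi> j) of (i, j) \<Rightarrow> p (\<phi> v) (\<phi> u) (j, i)) =
      (case (i, j) of (i, j) \<Rightarrow> p v u (j, i))"
    by (auto intro: invariant arcs_torus_sym)
qed

text \<open>Reversing all flows and reflecting \<open>T\<close> onto \<open>S\<close> turns the second phase into the first.\<close>

lemma side_bound_second_phase:
  assumes m: "1 \<le> m" "2 * m \<le> N"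
  shows "(of_int m)\<^sup>2 * ((of_int N)\<^sup>2 - (of_int m)\<^sup>2)
    \<le> 4 * (\<Sum>y=0..m-1. \<Sum>t\<in>square m m. \<Sum>w\<in>verts (torus N). p w t ((m-1, y), (m, y)))"
proof -
  interpret rev: flow_family N "\<lambda>u v (i, j). p v u (j, i)" by (rule reversed)
  \<comment> \<open>This reflection exchanges columns \<open>m - 1\<close> and \<open>m\<close>. It
    thus turns each link between the blocks around, which undoes the reversal of the links.\<close>
  let ?r = "reflect N (2 * m - 1)"
  have "rev.spread (square 0 m) ((m-1, y), (m, y)) =
      (\<Sum>t\<in>square m m. \<Sum>w\<in>verts (torus N). p w t ((m-1, y), (m, y)))"
    if y: "y \<in> {0..m-1}" for y
  proof -
    have arc: "((m, y), (m-1, y)) \<in> arcs (torus N)"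
      using m y by (intro arc_torusI[where e = "(-1,0)"]) (auto simp: verts_torus torus_add_def)
    have "rev.spread (square 0 m) (?r (m, y), ?r (m-1, y)) =
        rev.spread (square m m) ((m, y), (m-1, y))"
      using m by (intro rev.spread_invariant torus_automorphism_reflect bij_betw_reflect_square arc)
        (auto simp: square_def verts_torus)
    moreover have "?r (m, y) = (m-1, y)" "?r (m-1, y) = (m, y)"
      using m by (auto simp: reflect_def)
    ultimately show ?thesis by (simp add: rev.spread_def)
  qed
  then show ?thesis using rev.side_bound[OF m] by simp
qed

end

section \<open>The load of the links from \<open>S\<close> to \<open>T\<close>, by averaging\<close>

theorem mainTheorem3:
  fixes m N k :: int
    and S T :: "node set"
    and p :: "node \<Rightarrow> node \<Rightarrow> link \<Rightarrow> real"
    and f :: "node \<Rightarrow> node"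
    and d :: "node \<Rightarrow> node \<Rightarrow> real"
  assumes "m \<ge> 1" and "2 * m \<le> N" and "k = m\<^sup>2"
    and "S = {0..m-1} \<times> {0..m-1}"
    and "T = {m..2*m-1} \<times> {0..m-1}"
    and "vlb_flows N p"
    and "bij_betw f S T"
    and "\<And>s t. s \<in> verts (torus N) \<Longrightarrow> t \<in> verts (torus N) \<Longrightarrow>
           d s t = (if s \<in> S \<and> t = f s then 1 else 0)"
  shows "\<exists>l \<in> arcs (torus N).
           vlb_load N p d l \<ge> 2 * sqrt (of_int k) / 4 * (1 - of_int k / (of_int N)\<^sup>2)"
proof -
  note m = assms(1,2) and bij = assms(7)
  interpret flow_family N p
    using assms(6) by unfold_locales (fastforce simp: vlb_flows_def)+
  let ?V = "verts (torus N)" and ?l = "\<lambda>y. ((m-1, y), (m, y))"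
  have S: "S = square 0 m" and T: "T = square m m" using assms(4,5) by (auto simp: square_def)
  have SV: "S \<subseteq> ?V" and TV: "T \<subseteq> ?V" using assms(1,2,4,5) by (auto simp: verts_torus)
  have fV: "f s \<in> ?V" if "s \<in> S" for s using bij TV that by (auto simp: bij_betw_def)
  have load: "vlb_load N p d l = 1 / (of_int N)\<^sup>2 *
      (spread S l + (\<Sum>t\<in>T. \<Sum>w\<in>?V. p w t l))" for l
  proof -
    have "vlb_load N p d l = (\<Sum>s\<in>?V. \<Sum>t\<in>?V. d s t * vlb_amount N p s t l)"
      unfolding vlb_load_def by (simp add: sum.cartesian_product)
    also have "\<dots> = (\<Sum>s\<in>?V. if s \<in> S then vlb_amount N p s (f s) l else 0)"
    proof (rule sum.cong[OF refl])
      fix s assume s: "s \<in> ?V"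
      have "(\<Sum>t\<in>?V. d s t * vlb_amount N p s t l) =
          (\<Sum>t\<in>?V. if t = f s then (if s \<in> S then vlb_amount N p s t l else 0) else 0)"
        using assms(8)[OF s] by (intro sum.cong) auto
      then show "(\<Sum>t\<in>?V. d s t * vlb_amount N p s t l) =
          (if s \<in> S then vlb_amount N p s (f s) l else 0)"
        using fV by (auto simp: sum.delta)
    qed
    also have "\<dots> = (\<Sum>s\<in>S. vlb_amount N p s (f s) l)"
      using SV by (simp add: sum.If_cases Int_absorb1)
    also have "\<dots> = 1 / (of_int N)\<^sup>2 *
        (spread S l + (\<Sum>s\<in>S. \<Sum>w\<in>?V. p w (f s) l))"
      by (simp add: vlb_amount_def spread_def sum.distrib sum_distrib_left add_divide_distrib
          sum_divide_distrib)
    \<comment> \<open>The particular pairing \<open>f\<close> disappears: the second phase depends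
      only on the set of destinations.\<close>
    also have "(\<Sum>s\<in>S. \<Sum>w\<in>?V. p w (f s) l) = (\<Sum>t\<in>T. \<Sum>w\<in>?V. p w t l)"
      by (rule sum.reindex_bij_betw[OF bij])
    finally show ?thesis .
  qed
  \<comment> \<open>The claimed bound, with \<open>m\<close> for the square root of
    \<open>k\<close>. The factor 1/2 is one quarter from each phase.\<close>
  define B where "B = of_int m / 2 * (1 - (of_int m)\<^sup>2 / (of_int N)\<^sup>2 :: real)"
  have "of_int m * B = 1 / (of_int N)\<^sup>2 * (2 * ((of_int m)\<^sup>2 *
      ((of_int N)\<^sup>2 - (of_int m)\<^sup>2)) / 4)"
    using m by (simp add: B_def field_simps power2_eq_square)
  also have "\<dots> \<le> 1 / (of_int N)\<^sup>2 * ((\<Sum>y=0..m-1. spread S (?l y)) +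
      (\<Sum>y=0..m-1. \<Sum>t\<in>T. \<Sum>w\<in>?V. p w t (?l y)))"
    unfolding S T using side_bound[OF m] side_bound_second_phase[OF m]
    by (intro mult_left_mono) auto
  also have "\<dots> = (\<Sum>y=0..m-1. vlb_load N p d (?l y))"
    by (simp only: load sum.distrib sum_distrib_left[symmetric])
  finally have total: "(\<Sum>y=0..m-1. B) \<le> (\<Sum>y=0..m-1. vlb_load N p d (?l y))"
    using m by simp
  \<comment> \<open>If all \<open>m\<close> loads were below \<open>B\<close>, their sum would be
    below \<open>m * B\<close>; strictness uses \<open>m \<ge> 1\<close>.\<close>
  obtain y where y: "y \<in> {0..m-1}" "B \<le> vlb_load N p d (?l y)"
  proof (rule ccontr)
    assume "\<not> thesis"
    then have "\<forall>y\<in>{0..m-1}. vlb_load N p d (?l y) < B" using that by force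
    then have "(\<Sum>y=0..m-1. vlb_load N p d (?l y)) < (\<Sum>y=0..m-1. B)"
      using m by (intro sum_strict_mono) auto
    with total show False by simp
  qed
  have "?l y \<in> arcs (torus N)"
    using m y by (intro arc_torusI[where e = "(1,0)"]) (auto simp: verts_torus torus_add_def)
  moreover have "2 * sqrt (of_int k) / 4 * (1 - of_int k / (of_int N)\<^sup>2) = B"
    using m by (simp add: B_def assms(3))
  ultimately show ?thesis using y(2) by auto
qed

end
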